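(* Let $0<\alpha<1$, let $A$ be a real $2\times 2$ matrix, let $X_0\in\mathbb{R}^2$ and let $t_1>0$. Let $X(t)$, $t\ge 0$, be the solution of ${}_0^C\mathrm{D}_t^\alpha X(t)=AX(t)$ with $X(0)=X_0$, and let $Y(t)$, $t\ge 0$, be the solution of ${}_0^C\mathrm{D}_t^\alpha Y(t)=AY(t)$ with $Y(0)=X(t_1)$. Then $$Y(t)=TX(t)\quad\text{for all } t\ge 0,\qquad\text{where } T=E_\alpha(At_1^\alpha).$$ Moreover: (i) If $A$ has real distinct eigenvalues, then $T$ represents scaling (only). (ii) If $A$ has complex conjugate eigenvalues $a\pm ib$ (with $a,b\in\mathbb{R}$, $b\neq 0$), then $T$ represents both scaling and rotation.
   Context: The Caputo derivative of order $\alpha\in(0,1)$ is ${}_0^{C}\mathrm{D}_t^\alpha f(t)=\frac{1}{\Gamma(1-\alpha)}\int_0^t (t-\tau)^{-\alpha}f'(\tau)\,d\tau$ for $t>0$, applied componentwise to vector functions. A solution of ${}_0^C\mathrm{D}_t^\alpha X=AX$ is a function continuous on $[0,\infty)$, continuously differentiable on $(0,\infty)$ with derivative integrable near $0$, satisfying the equation for all $t>0$. It is known that the solution with $X(0)=X_0$ is $X(t)=E_\alpha(At^\alpha)X_0$. For a square matrix $M$, $E_\alpha(M)=\sum_{k=0}^\infty \frac{M^k}{\Gamma(\alpha k+1)}$ is the matrix Mittag-Leffler function. The terms "represents scaling (only)" and "represents both scaling and rotation" are understood in coordinates in which $A$ is in real canonical form. In case (i): for every real invertible $P$ such that $P^{-1}AP=\begin{bmatrix}\lambda_1&0\\0&\lambda_2\end{bmatrix}$,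 the matrix $P^{-1}TP$ is a scaling matrix, i.e. a real diagonal matrix. In case (ii): for every real invertible $P$ such that $P^{-1}AP=\begin{bmatrix}a&b\\-b&a\end{bmatrix}$, the matrix $P^{-1}TP$ is a product $UV$ of a scaling matrix $U$ (real diagonal) and a rotation matrix $V$ (an element of $SO(2)$). *)

theory Defs
  imports "HOL-Analysis.Analysis"
begin

definition caputo :: "real \<Rightarrow> (real \<Rightarrow> real) \<Rightarrow> real \<Rightarrow> real" where
  "caputo \<alpha> f t =
     1 / Gamma (1 - \<alpha>) * (LINT \<tau>:{0<..<t}|lborel. (t - \<tau>) powr (- \<alpha>) * deriv f \<tau>)"

definition caputo_vec :: "real \<Rightarrow> (real \<Rightarrow> real ^ 'n) \<Rightarrow> real \<Rightarrow> real ^ 'n" where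
  "caputo_vec \<alpha> X t = (\<chi> i. caputo \<alpha> (\<lambda>s. X s $ i) t)"

text \<open>Only the values of \<open>X\<close> on \<open>[0, \<infinity>)\<close> matter: derivatives are taken at
  positive times only. Integrability near \<open>0\<close> is Lebesgue integrability.\<close>

definition caputo_solution :: "real \<Rightarrow> real ^ 'n ^ 'n \<Rightarrow> (real \<Rightarrow> real ^ 'n) \<Rightarrow> bool" where
  "caputo_solution \<alpha> A X \<longleftrightarrow>
     continuous_on {0..} X \<and>
     X C1_differentiable_on {0<..} \<and>
     (\<exists>\<delta>>0. set_integrable lborel {0<..<\<delta>} (\<lambda>t. vector_derivative X (at t))) \<and>
     (\<forall>t>0. caputo_vec \<alpha> X t = A *v X t)"

text \<open>The class operations \<open>*\<close> and \<open>^\<close> on matrices are entrywise, hence a separate power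
  for the matrix product.\<close>

definition mat_pow :: "'a::semiring_1 ^ 'n ^ 'n \<Rightarrow> nat \<Rightarrow> 'a ^ 'n ^ 'n" where
  "mat_pow M k = (((**) M) ^^ k) (mat 1)"

definition mittag_leffler_mat :: "real \<Rightarrow> real ^ 'n ^ 'n \<Rightarrow> real ^ 'n ^ 'n" where
  "mittag_leffler_mat \<alpha> M = (\<Sum>k. mat_pow M k /\<^sub>R Gamma (\<alpha> * real k + 1))"

definition eigenvalue :: "'a::field ^ 'n ^ 'n \<Rightarrow> 'a \<Rightarrow> bool" where
  "eigenvalue M z \<longleftrightarrow> (\<exists>v. v \<noteq> 0 \<and> M *v v = z *s v)"

definition mat2 :: "'a::zero \<Rightarrow> 'a \<Rightarrow> 'a \<Rightarrow> 'a \<Rightarrow> 'a ^ 2 ^ 2" where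
  "mat2 p q r s = vector [vector [p, q], vector [r, s]]"

definition scaling_matrix :: "real ^ 'n ^ 'n \<Rightarrow> bool" where
  "scaling_matrix M \<longleftrightarrow> (\<forall>i j. i \<noteq> j \<longrightarrow> M $ i $ j = 0)"

text \<open>\<open>rotation_matrix\<close> is membership in the special orthogonal group. Neither factor
  is required to be nontrivial, and the scaling factor may have zero or negative entries.\<close>

definition scaling_rotation_matrix :: "real ^ 'n ^ 'n \<Rightarrow> bool" where
  "scaling_rotation_matrix M \<longleftrightarrow>
     (\<exists>U V. scaling_matrix U \<and> rotation_matrix V \<and> M = U ** V)"

end

theory Submission
  imports Defs
begin

text \<open>Integrating the equation against \<open>(t - s) powr (\<alpha> - 1)\<close> turns it into the Volterra equation
  \<open>X = X 0 + I\<^sup>\<alpha> (A X)\<close>, where \<open>I\<^sup>\<alpha>\<close> is the Riemann--Liouville integral. Iterating the latter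
  produces the partial sums of the Mittag-Leffler series with a remainder that tends to \<open>0\<close>, so every
  solution is \<open>E\<^sub>\<alpha>(A t\<^sup>\<alpha>) X(0)\<close>. The values \<open>E\<^sub>\<alpha>(A t\<^sup>\<alpha>)\<close> commute with each other, which gives the
  first claim. For the other two, the diagonal matrices and the matrices \<open>[[c, d], [-d, c]]\<close> form
  linear subspaces closed under multiplication by the canonical form of \<open>A\<close>, and subspaces are
  closed, hence contain the limit of the series.\<close>

section \<open>Beta integrals and the composition of fractional kernels\<close>

text \<open>The substitution \<open>s = u + (v - u) * t\<close> reduces this to Euler's Beta
  integral on the unit interval. The form \<open>has_bochner_integral\<close> carries integrability
  and value together; Fubini and the power rule below need both.\<close>

lemma has_bochner_integral_Beta_Ioo:
  fixes a b u v :: real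
  assumes "a > 0" "b > 0" "u < v"
  shows "has_bochner_integral lborel
    (\<lambda>s. indicator {u<..<v} s * ((v - s) powr (a - 1) * (s - u) powr (b - 1)))
    (Beta a b * (v - u) powr (a + b - 1))"
proof -
  have int: "set_integrable lborel {0<..<1} (\<lambda>t. t powr (b - 1) * (1 - t) powr (a - 1))"
    by (rule set_integrable_subset[OF integrable_Beta]) (use assms in auto)
  have val: "((\<lambda>t. t powr (b - 1) * (1 - t) powr (a - 1)) has_integral Beta a b) {0<..<1}"
    using has_integral_Beta_real[of b a] assms
    by (simp add: has_integral_Icc_iff_Ioo Beta_commute)
  have unit: "has_bochner_integral lborel
      (\<lambda>t. indicator {0<..<1} t * (t powr (b - 1) * (1 - t) powr (a - 1))) (Beta a b)"
    using set_borel_integral_eq_integral(2)[OF int] integral_unique[OF val] int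
    by (simp add: has_bochner_integral_iff set_integrable_def set_lebesgue_integral_def)
  let ?f = "\<lambda>s. indicator {u<..<v} s * ((v - s) powr (a - 1) * (s - u) powr (b - 1))"
  have "?f (u + (v - u) * t) = indicator {0<..<1} t * (t powr (b - 1) * (1 - t) powr (a - 1))
      * (v - u) powr (a + b - 2)" for t
  proof (cases "0 < t \<and> t < 1")
    case True
    have "u + (v - u) * t < u + (v - u) * 1"
      using True assms by (intro add_strict_left_mono mult_strict_left_mono) auto
    then have "u + (v - u) * t \<in> {u<..<v}"
      using True assms by auto
    moreover have "v - (u + (v - u) * t) = (v - u) * (1 - t)"
      by (simp add: algebra_simps)
    moreover have "(v - u) powr (a - 1) * (v - u) powr (b - 1) = (v - u) powr (a + b - 2)"
      by (simp add: powr_add[symmetric])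
    ultimately show ?thesis
      using True assms by (simp add: powr_mult mult_ac)
  next
    case False
    have "u + (v - u) * t \<notin> {u<..<v}"
    proof
      assume *: "u + (v - u) * t \<in> {u<..<v}"
      then have pos: "0 < (v - u) * t" and lt: "(v - u) * t < v - u"
        by (simp_all add: algebra_simps)
      from pos have "0 < t"
        using assms by (simp add: zero_less_mult_iff)
      moreover have "t < 1"
      proof (rule ccontr)
        assume "\<not> t < 1"
        then have "(v - u) * 1 \<le> (v - u) * t"
          using assms by (intro mult_left_mono) auto
        with lt show False by (metis mult_1_right not_less)
      qed
      ultimately show False using False by simp
    qed
    with False show ?thesis
      by (auto simp: indicator_def)
  qed
  then have "(\<lambda>t. ?f (u + (v - u) * t)) = (\<lambda>t. indicator {0<..<1} t * (t powr (b - 1) * (1 - t) powr (a - 1))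
      * (v - u) powr (a + b - 2))"
    by blast
  \<comment> \<open>The affine change of variables divides by \<open>v - u\<close>, hence the drop
    of the exponent from \<open>a + b - 1\<close> to \<open>a + b - 2\<close>.\<close>
  moreover have "(v - u) powr (a + b - 1) = (v - u) powr (a + b - 2) * (v - u)"
    using assms powr_add[of "v - u" "a + b - 2" 1] by (simp add: algebra_simps)
  then have "(Beta a b * (v - u) powr (a + b - 1)) /\<^sub>R \<bar>v - u\<bar> = Beta a b * (v - u) powr (a + b - 2)"
    using assms by simp
  ultimately have "has_bochner_integral lborel (\<lambda>t. ?f (u + (v - u) * t))
      ((Beta a b * (v - u) powr (a + b - 1)) /\<^sub>R \<bar>v - u\<bar>)"
    using has_bochner_integral_mult_left[OF unit, of "(v - u) powr (a + b - 2)"] by (simp only:)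
  then show ?thesis
    using lborel_has_bochner_integral_real_affine_iff[of "v - u" ?f _ u] assms by simp
qed

text \<open>By Fubini the two singular kernels combine to the constant
  \<open>Beta \<alpha> (1 - \<alpha>) = Gamma \<alpha> * Gamma (1 - \<alpha>)\<close>.\<close>

lemma fractional_integral_caputo_kernel:
  fixes \<alpha> t :: real and g :: "real \<Rightarrow> real"
  assumes "0 < \<alpha>" "\<alpha> < 1" and g: "set_integrable lborel {0<..<t} g"
  shows "(LINT s:{0<..<t}|lborel. (t - s) powr (\<alpha> - 1) *
            (LINT \<tau>:{0<..<s}|lborel. (s - \<tau>) powr (- \<alpha>) * g \<tau>))
       = Gamma \<alpha> * Gamma (1 - \<alpha>) * (LINT \<tau>:{0<..<t}|lborel. g \<tau>)"
proof -
  define h where "h \<tau> = indicator {0<..<t} \<tau> * g \<tau>" for \<tau>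
  have h: "integrable lborel h"
    using g by (simp add: h_def[abs_def] set_integrable_def)
  then have [measurable]: "h \<in> borel_measurable borel"
    using borel_measurable_integrable by fastforce
  \<comment> \<open>The support \<open>\<tau> < s < t\<close> is built into the kernel, so both
    iterated integrals run over the whole line and no variable limits have to be exchanged.\<close>
  define k where "k \<tau> s = indicator {\<tau><..<t} s * ((t - s) powr (\<alpha> - 1) * (s - \<tau>) powr (- \<alpha>))"
    for \<tau> s
  have k_alt: "k \<tau> s = (if \<tau> < s \<and> s < t then (t - s) powr (\<alpha> - 1) * (s - \<tau>) powr (- \<alpha>) else 0)"
    for \<tau> s by (auto simp: k_def)
  have k_meas: "(\<lambda>p. k (fst p) (snd p)) \<in> borel_measurable (lborel \<Otimes>\<^sub>M lborel)"
    unfolding k_alt by measurable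
  have k_nonneg: "0 \<le> k \<tau> s" for \<tau> s
    by (auto simp: k_def)
  \<comment> \<open>The Beta parameters \<open>\<alpha>\<close> and \<open>1 - \<alpha>\<close> add
    up to 1, so \<open>t - \<tau>\<close> occurs with exponent 0 and the value does not depend on
    \<open>\<tau>\<close>.\<close>
  have k_int: "has_bochner_integral lborel (k \<tau>) (Gamma \<alpha> * Gamma (1 - \<alpha>))" if "\<tau> < t" for \<tau>
    using has_bochner_integral_Beta_Ioo[of \<alpha> "1 - \<alpha>" \<tau> t] that assms
    by (simp add: k_def[abs_def] Beta_def)
  have kh: "has_bochner_integral lborel (\<lambda>s. k \<tau> s * h \<tau>) (Gamma \<alpha> * Gamma (1 - \<alpha>) * h \<tau>)" for \<tau>
  proof (cases "\<tau> < t")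
    case False
    then have "h \<tau> = 0" by (simp add: h_def)
    then show ?thesis by (simp add: has_bochner_integral_zero)
  qed (auto intro: has_bochner_integral_mult_left k_int)
  \<comment> \<open>The inner integral of the norm is a constant multiple of
    \<open>\<bar>h \<tau>\<bar>\<close>, whose integrability is what Fubini asks for.\<close>
  have kh_norm: "has_bochner_integral lborel (\<lambda>s. norm (k \<tau> s * h \<tau>)) (Gamma \<alpha> * Gamma (1 - \<alpha>) * \<bar>h \<tau>\<bar>)" for \<tau>
  proof (cases "\<tau> < t")
    case False
    then have "h \<tau> = 0" by (simp add: h_def)
    then show ?thesis by (simp add: has_bochner_integral_zero)
  next
    case True
    then show ?thesis
      using has_bochner_integral_mult_left[OF k_int[OF True], of "\<bar>h \<tau>\<bar>"] k_nonneg
      by (simp add: abs_mult)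
  qed
  have "integrable (lborel \<Otimes>\<^sub>M lborel) (\<lambda>(\<tau>, s). k \<tau> s * h \<tau>)"
  proof (rule lborel_pair.Fubini_integrable)
    show "(\<lambda>(\<tau>, s). k \<tau> s * h \<tau>) \<in> borel_measurable (lborel \<Otimes>\<^sub>M lborel)"
      using k_meas unfolding case_prod_beta by measurable
    show "integrable lborel (\<lambda>\<tau>. \<integral>s. norm (case (\<tau>, s) of (\<tau>, s) \<Rightarrow> k \<tau> s * h \<tau>) \<partial>lborel)"
      using kh_norm[THEN has_bochner_integral_integral_eq] h by simp
    have "integrable lborel (\<lambda>s. k \<tau> s * h \<tau>)" for \<tau>
      using kh by (rule integrable.intros)
    then show "AE \<tau> in lborel. integrable lborel (\<lambda>s. case (\<tau>, s) of (\<tau>, s) \<Rightarrow> k \<tau> s * h \<tau>)"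
      unfolding prod.case by (rule AE_I2)
  qed
  then have "(\<integral>s. (\<integral>\<tau>. k \<tau> s * h \<tau> \<partial>lborel) \<partial>lborel) = (\<integral>\<tau>. (\<integral>s. k \<tau> s * h \<tau> \<partial>lborel) \<partial>lborel)"
    by (rule lborel_pair.Fubini_integral)
  also have "\<dots> = (\<integral>\<tau>. Gamma \<alpha> * Gamma (1 - \<alpha>) * h \<tau> \<partial>lborel)"
    by (simp only: kh[THEN has_bochner_integral_integral_eq])
  also have "\<dots> = Gamma \<alpha> * Gamma (1 - \<alpha>) * (LINT \<tau>:{0<..<t}|lborel. g \<tau>)"
    by (simp add: set_lebesgue_integral_def h_def)
  also have "(\<integral>s. (\<integral>\<tau>. k \<tau> s * h \<tau> \<partial>lborel) \<partial>lborel) =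
      (LINT s:{0<..<t}|lborel. (t - s) powr (\<alpha> - 1) *
            (LINT \<tau>:{0<..<s}|lborel. (s - \<tau>) powr (- \<alpha>) * g \<tau>))"
    unfolding set_lebesgue_integral_def
  proof (rule Bochner_Integration.integral_cong[OF refl])
    fix s :: real
    show "(\<integral>\<tau>. k \<tau> s * h \<tau> \<partial>lborel) = indicator {0<..<t} s *\<^sub>R ((t - s) powr (\<alpha> - 1) *
            (\<integral>\<tau>. indicator {0<..<s} \<tau> *\<^sub>R ((s - \<tau>) powr (- \<alpha>) * g \<tau>) \<partial>lborel))"
    proof (cases "s \<in> {0<..<t}")
      case True
      then have "k \<tau> s * h \<tau> = (t - s) powr (\<alpha> - 1) *
          (indicator {0<..<s} \<tau> *\<^sub>R ((s - \<tau>) powr (- \<alpha>) * g \<tau>))" for \<tau>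
        by (auto simp: k_def h_def indicator_def)
      with True show ?thesis by simp
    next
      case False
      then have "(\<lambda>\<tau>. k \<tau> s * h \<tau>) = (\<lambda>_. 0)"
        by (auto simp: k_def h_def indicator_def)
      with False show ?thesis by simp
    qed
  qed
  finally show ?thesis .
qed

section \<open>Growth of Gamma and the scalar Mittag-Leffler series\<close>

text \<open>On \<open>{r..}\<close> the integrand of Gamma is at least
  \<open>r powr y * exp (- t)\<close>, and this tail integrates to the bound. As \<open>r\<close> is
  free, Gamma outgrows every geometric sequence.\<close>

lemma Gamma_plus1_ge:
  fixes y r :: real
  assumes "0 \<le> y" "0 < r"
  shows "r powr y * exp (- r) \<le> Gamma (y + 1)"
proof -
  have Gam: "((\<lambda>t. t powr y / exp t) has_integral Gamma (y + 1)) {0..}"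
    using Gamma_integral_real[of "y + 1"] assms by simp
  have "((\<lambda>t. r powr y * exp (- t)) has_integral r powr y * exp (- r)) {r..}"
    using has_integral_mult_right[OF has_integral_exp_minus_to_infinity[of 1 r]] by simp
  then have "((\<lambda>t. if t \<in> {r..} then r powr y * exp (- t) else 0) has_integral r powr y * exp (- r)) {0..}"
    using assms by (subst has_integral_restrict) auto
  then show ?thesis
    by (rule has_integral_le[OF _ Gam])
      (use assms in \<open>auto simp: exp_minus divide_inverse intro!: mult_right_mono powr_mono2\<close>)
qed

lemma summable_mittag_leffler:
  fixes \<alpha> x :: real
  assumes "0 < \<alpha>" "0 \<le> x"
  shows "summable (\<lambda>k. x ^ k / Gamma (\<alpha> * real k + 1))"
proof -
  \<comment> \<open>Chosen to turn \<open>r powr (\<alpha> * real k)\<close> into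
    \<open>(2 * x + 1) ^ k\<close>: the factor 2 leaves a geometric series of ratio
    \<open>1 / 2\<close>, and the summand 1 keeps the base positive when
    \<open>x = 0\<close>.\<close>
  define r where "r = (2 * x + 1) powr (1 / \<alpha>)"
  have r: "r > 0" and r': "r powr (\<alpha> * real k) = (2 * x + 1) ^ k" for k
    using assms by (auto simp: r_def powr_powr powr_realpow)
  have "norm (x ^ k / Gamma (\<alpha> * real k + 1)) \<le> exp r * (1 / 2) ^ k" for k
  proof -
    have "(2 * x) ^ k \<le> (2 * x + 1) ^ k"
      using assms by (intro power_mono) auto
    also have "\<dots> \<le> exp r * Gamma (\<alpha> * real k + 1)"
      using Gamma_plus1_ge[of "\<alpha> * real k" r] assms r r'[of k] by (simp add: exp_minus field_simps)
    finally have "x ^ k \<le> exp r * (1 / 2) ^ k * Gamma (\<alpha> * real k + 1)"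
      by (simp add: power_mult_distrib power_divide field_simps)
    moreover have "Gamma (\<alpha> * real k + 1) > 0"
      using assms by (simp add: add_nonneg_pos)
    ultimately show ?thesis
      using assms by (simp add: field_simps)
  qed
  moreover have "summable (\<lambda>k. exp r * (1 / 2) ^ k)"
    by (intro summable_mult summable_geometric) auto
  ultimately show ?thesis
    by (rule summable_comparison_test'[rotated, where N = 0])
qed

section \<open>The Riemann-Liouville integral of powers and of continuous functions\<close>

definition riemann_liouville :: "real \<Rightarrow> (real \<Rightarrow> 'a::{banach, second_countable_topology}) \<Rightarrow> real \<Rightarrow> 'a" where
  "riemann_liouville \<alpha> g t =
     (LINT s:{0<..<t}|lborel. (t - s) powr (\<alpha> - 1) *\<^sub>R g s) /\<^sub>R Gamma \<alpha>"

text \<open>\<open>Gamma (\<beta> + 1)\<close> cancels against the same factor in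
  \<open>Beta \<alpha> (\<beta> + 1)\<close>. Up to the factor \<open>Gamma \<alpha>\<close>,
  integration thus takes one coefficient of the Mittag-Leffler series to the next.\<close>

lemma has_bochner_integral_riemann_liouville_powr:
  fixes \<alpha> \<beta> t :: real and v :: "'a::{banach, second_countable_topology}"
  assumes "0 < \<alpha>" "0 \<le> \<beta>" "0 < t"
  shows "has_bochner_integral lborel
    (\<lambda>s. indicator {0<..<t} s *\<^sub>R ((t - s) powr (\<alpha> - 1) *\<^sub>R ((s powr \<beta> / Gamma (\<beta> + 1)) *\<^sub>R v)))
    ((Gamma \<alpha> * (t powr (\<beta> + \<alpha>) / Gamma (\<beta> + \<alpha> + 1))) *\<^sub>R v)"
proof -
  have "Gamma (\<beta> + 1) > 0"
    using assms by (simp add: add_nonneg_pos)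
  then have eq: "Beta \<alpha> (\<beta> + 1) * t powr (\<alpha> + \<beta>) / Gamma (\<beta> + 1)
      = Gamma \<alpha> * (t powr (\<beta> + \<alpha>) / Gamma (\<beta> + \<alpha> + 1))"
    by (simp add: Beta_def add_ac)
  have "has_bochner_integral lborel
    (\<lambda>s. indicator {0<..<t} s * ((t - s) powr (\<alpha> - 1) * s powr \<beta>) / Gamma (\<beta> + 1))
    (Beta \<alpha> (\<beta> + 1) * t powr (\<alpha> + \<beta>) / Gamma (\<beta> + 1))"
    using has_bochner_integral_Beta_Ioo[of \<alpha> "\<beta> + 1" 0 t] assms
    by (intro has_bochner_integral_divide) simp
  from has_bochner_integral_scaleR_left[OF this[unfolded eq], of v]
  show ?thesis by (simp add: mult_ac)
qed

text \<open>By compactness \<open>g\<close> is bounded, and a constant times the kernel is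
  integrable because \<open>\<alpha>\<close> is positive; domination does the rest.\<close>

lemma set_integrable_riemann_liouville:
  fixes \<alpha> t :: real and g :: "real \<Rightarrow> 'a::{banach, second_countable_topology}"
  assumes "0 < \<alpha>" "0 < t" and cont: "continuous_on {0..t} g"
  shows "set_integrable lborel {0<..<t} (\<lambda>s. (t - s) powr (\<alpha> - 1) *\<^sub>R g s)"
proof -
  have "compact (g ` {0..t})"
    using cont by (intro compact_continuous_image) auto
  then obtain M where M: "\<And>s. s \<in> {0..t} \<Longrightarrow> norm (g s) \<le> M"
    by (meson compact_imp_bounded bounded_iff image_eqI)
  have "has_bochner_integral lborel
      (\<lambda>s. indicator {0<..<t} s * (t - s) powr (\<alpha> - 1) * M) (Beta \<alpha> 1 * t powr \<alpha> * M)"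
  proof (rule has_bochner_integral_mult_left)
    \<comment> \<open>The extra factor has exponent 0 and equals 1 except at \<open>s = 0\<close>,
      where \<open>powr\<close> gives 0; the indicator hides that point.\<close>
    have "(\<lambda>s. indicator {0<..<t} s * (t - s) powr (\<alpha> - 1)) =
      (\<lambda>s. indicator {0<..<t} s * ((t - s) powr (\<alpha> - 1) * (s - 0) powr (1 - 1)))"
      by (auto simp: indicator_def)
    then show "has_bochner_integral lborel
      (\<lambda>s. indicator {0<..<t} s * (t - s) powr (\<alpha> - 1)) (Beta \<alpha> 1 * t powr \<alpha>)"
      using has_bochner_integral_Beta_Ioo[of \<alpha> 1 0 t] assms by simp
  qed
  then have dom: "integrable lborel (\<lambda>s. indicator {0<..<t} s * (t - s) powr (\<alpha> - 1) * M)"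
    by (rule integrable.intros)
  \<comment> \<open>Continuity is known on \<open>{0..t}\<close> only, so measurability is derived
    for the truncation of \<open>g\<close>.\<close>
  have "set_integrable lborel {0<..<t} g"
    by (rule set_integrable_subset[OF borel_integrable_atLeastAtMost'[OF cont]]) auto
  then have [measurable]: "(\<lambda>s. indicator {0<..<t} s *\<^sub>R g s) \<in> borel_measurable lborel"
    unfolding set_integrable_def by (rule borel_measurable_integrable)
  have "(\<lambda>s. (t - s) powr (\<alpha> - 1) *\<^sub>R (indicator {0<..<t} s *\<^sub>R g s)) \<in> borel_measurable lborel"
    by measurable
  moreover have "(\<lambda>s. (t - s) powr (\<alpha> - 1) *\<^sub>R (indicator {0<..<t} s *\<^sub>R g s)) =
      (\<lambda>s. indicator {0<..<t} s *\<^sub>R ((t - s) powr (\<alpha> - 1) *\<^sub>R g s))"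
    by (auto simp: indicator_def)
  moreover have "norm (indicator {0<..<t} s *\<^sub>R ((t - s) powr (\<alpha> - 1) *\<^sub>R g s))
      \<le> norm (indicator {0<..<t} s * (t - s) powr (\<alpha> - 1) * M)" for s
  proof (cases "s \<in> {0<..<t}")
    case True
    then have "norm (g s) \<le> \<bar>M\<bar>"
      using M[of s] by auto
    with True show ?thesis
      by (simp add: abs_mult mult_left_mono)
  qed simp
  ultimately show ?thesis
    unfolding set_integrable_def by (intro Bochner_Integration.integrable_bound[OF dom]) auto
qed

section \<open>From the Caputo equation to a Volterra equation\<close>

text \<open>In each component the two singular kernels combine to
  \<open>Gamma \<alpha> * Gamma (1 - \<alpha>)\<close>, which cancels both normalisations. What
  remains is the integral of the derivative, evaluated by the fundamental theorem of
  calculus.\<close>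

lemma caputo_solution_volterra:
  fixes A :: "real ^ 'n ^ 'n"
  assumes "0 < \<alpha>" "\<alpha> < 1" and X: "caputo_solution \<alpha> A X" and "0 < t"
  shows "X t = X 0 + riemann_liouville \<alpha> (\<lambda>s. A *v X s) t"
proof -
  from X have cont: "continuous_on {0..} X"
    and eq: "\<And>s. s > 0 \<Longrightarrow> caputo_vec \<alpha> X s = A *v X s"
    by (auto simp: caputo_solution_def)
  from X obtain D where D: "\<And>s. s > 0 \<Longrightarrow> (X has_vector_derivative D s) (at s)"
    and contD: "continuous_on {0<..} D"
    by (auto simp: caputo_solution_def C1_differentiable_on_def)
  from X obtain \<delta> where "\<delta> > 0"
    and "set_integrable lborel {0<..<\<delta>} (\<lambda>t. vector_derivative X (at t))"
    by (auto simp: caputo_solution_def)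
  moreover have "set_integrable lborel {0<..<\<delta>} (\<lambda>t. vector_derivative X (at t))
      = set_integrable lborel {0<..<\<delta>} D"
    by (rule set_integrable_cong) (auto intro!: vector_derivative_at D)
  ultimately have "set_integrable lborel {0<..<\<delta>} D"
    by simp
  \<comment> \<open>Starting at \<open>\<delta> / 2\<close> keeps the interval inside the positive
    axis, where \<open>D\<close> is continuous, and makes it overlap the neighbourhood of 0.\<close>
  moreover have "set_integrable lborel {\<delta> / 2..t} D"
    using \<open>\<delta> > 0\<close> by (intro borel_integrable_atLeastAtMost' continuous_on_subset[OF contD]) auto
  ultimately have "set_integrable lborel ({0<..<\<delta>} \<union> {\<delta> / 2..t}) D"
    by (rule set_integrable_Un) auto
  then have intD: "set_integrable lborel {0<..<t} D"
    by (rule set_integrable_subset) (use \<open>\<delta> > 0\<close> in auto)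
  have contAX: "continuous_on {0..t} (\<lambda>s. A *v X s)"
    by (rule bounded_linear.continuous_on[OF matrix_vector_mul_bounded_linear continuous_on_subset[OF cont]]) auto
  have "riemann_liouville \<alpha> (\<lambda>s. A *v X s) t $ i = X t $ i - X 0 $ i" for i
  proof -
    have intDi: "set_integrable lborel {0<..<t} (\<lambda>s. D s $ i)"
      using integrable_bounded_linear[OF bounded_linear_vec_nth intD[unfolded set_integrable_def], of i]
      by (simp add: set_integrable_def)
    have Di: "((\<lambda>s. X s $ i) has_vector_derivative D s $ i) (at s)" if "s > 0" for s
      using bounded_linear.has_vector_derivative[OF bounded_linear_vec_nth D[OF that]] .
    \<comment> \<open>At 0 the solution is only continuous, hence the interior form of the
      fundamental theorem.\<close>
    have "((\<lambda>s. D s $ i) has_integral (X t $ i - X 0 $ i)) {0..t}"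
      using \<open>0 < t\<close> by (intro fundamental_theorem_of_calculus_interior Di
          continuous_intros continuous_on_subset[OF cont]) auto
    then have "integral {0<..<t} (\<lambda>s. D s $ i) = X t $ i - X 0 $ i"
      by (simp add: has_integral_Icc_iff_Ioo integral_unique)
    then have FTC: "(LINT s:{0<..<t}|lborel. D s $ i) = X t $ i - X 0 $ i"
      using set_borel_integral_eq_integral(2)[OF intDi] by simp
    have AX: "(A *v X s) $ i = (LINT \<tau>:{0<..<s}|lborel. (s - \<tau>) powr (- \<alpha>) * D \<tau> $ i) / Gamma (1 - \<alpha>)"
      if "s > 0" for s
    proof -
      have "deriv (\<lambda>s. X s $ i) \<tau> = D \<tau> $ i" if "\<tau> > 0" for \<tau>
        using Di[OF that] by (intro DERIV_imp_deriv) (simp add: has_real_derivative_iff_has_vector_derivative)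
      then have "(LINT \<tau>:{0<..<s}|lborel. (s - \<tau>) powr (- \<alpha>) * deriv (\<lambda>s. X s $ i) \<tau>)
          = (LINT \<tau>:{0<..<s}|lborel. (s - \<tau>) powr (- \<alpha>) * D \<tau> $ i)"
        by (intro set_lebesgue_integral_cong) auto
      then show ?thesis
        unfolding eq[OF that, symmetric] by (simp add: caputo_vec_def caputo_def)
    qed
    have "riemann_liouville \<alpha> (\<lambda>s. A *v X s) t $ i
        = (LINT s:{0<..<t}|lborel. (t - s) powr (\<alpha> - 1) * (A *v X s) $ i) / Gamma \<alpha>"
      using integral_bounded_linear[OF bounded_linear_vec_nth
          set_integrable_riemann_liouville[OF \<open>0 < \<alpha>\<close> \<open>0 < t\<close> contAX, unfolded set_integrable_def], of i]
      by (simp add: riemann_liouville_def set_lebesgue_integral_def divide_inverse mult.assoc)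
    also have "(LINT s:{0<..<t}|lborel. (t - s) powr (\<alpha> - 1) * (A *v X s) $ i)
        = (LINT s:{0<..<t}|lborel. (t - s) powr (\<alpha> - 1) *
            (LINT \<tau>:{0<..<s}|lborel. (s - \<tau>) powr (- \<alpha>) * D \<tau> $ i) / Gamma (1 - \<alpha>))"
      by (intro set_lebesgue_integral_cong) (auto simp: AX)
    also have "\<dots> = (LINT s:{0<..<t}|lborel. (t - s) powr (\<alpha> - 1) *
            (LINT \<tau>:{0<..<s}|lborel. (s - \<tau>) powr (- \<alpha>) * D \<tau> $ i)) / Gamma (1 - \<alpha>)"
      by (rule set_integral_divide_zero)
    also have "\<dots> = Gamma \<alpha> * (X t $ i - X 0 $ i)"
      using fractional_integral_caputo_kernel[OF assms(1,2) intDi] FTC assms(2)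
        Gamma_real_pos[of "1 - \<alpha>"] by (simp add: less_imp_neq[symmetric])
    finally show ?thesis
      using Gamma_real_pos[OF \<open>0 < \<alpha>\<close>] by simp
  qed
  then show ?thesis
    by (simp add: vec_eq_iff)
qed

section \<open>Matrix powers and the matrix Mittag-Leffler function\<close>

lemma linear_matrix_mult_left: "linear (\<lambda>M. B ** M)"
  for B :: "real ^ 'n ^ 'm"
  by (rule linearI) (simp_all add: vec_eq_iff matrix_matrix_mult_def sum.distrib sum_distrib_left algebra_simps)

lemma linear_matrix_mult_right: "linear (\<lambda>M. M ** B)"
  for B :: "real ^ 'n ^ 'm"
  by (rule linearI) (simp_all add: vec_eq_iff matrix_matrix_mult_def sum.distrib sum_distrib_left algebra_simps)

lemma mat_pow_0 [simp]: "mat_pow M 0 = mat 1"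
  by (simp add: mat_pow_def)

lemma mat_pow_Suc [simp]: "mat_pow M (Suc k) = M ** mat_pow M k"
  by (simp add: mat_pow_def)

lemma mat_pow_scaleR: "mat_pow (c *\<^sub>R M) k = c ^ k *\<^sub>R mat_pow M k"
  for M :: "real ^ 'n ^ 'n"
  by (induction k) (simp_all add: linear_cmul[OF linear_matrix_mult_left]
      linear_cmul[OF linear_matrix_mult_right])

text \<open>Left multiplication by \<open>M\<close> is bounded with some constant \<open>K\<close>,
  so \<open>K ^ k\<close> controls the powers and the scalar series at \<open>K\<close>
  dominates.\<close>

lemma summable_mittag_leffler_mat:
  fixes M :: "real ^ 'n ^ 'n"
  assumes "0 < \<alpha>"
  shows "summable (\<lambda>k. mat_pow M k /\<^sub>R Gamma (\<alpha> * real k + 1))"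
proof -
  obtain K where "K > 0" and K: "\<And>N :: real ^ 'n ^ 'n. norm (M ** N) \<le> norm N * K"
    using bounded_linear.pos_bounded linear_conv_bounded_linear linear_matrix_mult_left by blast
  have le: "norm (mat_pow M k) \<le> K ^ k * norm (mat 1 :: real ^ 'n ^ 'n)" for k
  proof (induction k)
    case (Suc k)
    have "norm (mat_pow M (Suc k)) \<le> norm (mat_pow M k) * K"
      using K by simp
    also have "\<dots> \<le> K ^ k * norm (mat 1 :: real ^ 'n ^ 'n) * K"
      using Suc \<open>K > 0\<close> by (intro mult_right_mono) auto
    finally show ?case by (simp add: mult_ac)
  qed simp
  have pos: "Gamma (\<alpha> * real k + 1) > 0" for k
    using assms by (simp add: add_nonneg_pos)
  have "norm (mat_pow M k /\<^sub>R Gamma (\<alpha> * real k + 1))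
      \<le> K ^ k / Gamma (\<alpha> * real k + 1) * norm (mat 1 :: real ^ 'n ^ 'n)" for k
    using le[of k] pos[of k] by (simp add: field_simps)
  moreover have "summable (\<lambda>k. K ^ k / Gamma (\<alpha> * real k + 1) * norm (mat 1 :: real ^ 'n ^ 'n))"
    using summable_mittag_leffler[OF assms, of K] \<open>K > 0\<close> by (intro summable_mult2) simp
  ultimately show ?thesis
    by (rule summable_comparison_test'[rotated, where N = 0])
qed

text \<open>An induction principle for the series: partial sums stay in \<open>S\<close>, and a
  subspace of a finite-dimensional space is closed. Commutation and both canonical forms are
  instances.\<close>

lemma mittag_leffler_mat_in_subspace:
  fixes M :: "real ^ 'n ^ 'n"
  assumes "0 < \<alpha>" and S: "subspace S" "mat 1 \<in> S"
    and step: "\<And>N. N \<in> S \<Longrightarrow> M ** N \<in> S"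
  shows "mittag_leffler_mat \<alpha> M \<in> S"
proof -
  have "mat_pow M k \<in> S" for k
    by (induction k) (auto intro: assms)
  then have "(\<Sum>k<n. mat_pow M k /\<^sub>R Gamma (\<alpha> * real k + 1)) \<in> S" for n
    by (intro subspace_sum subspace_scale S)
  then show ?thesis
    unfolding mittag_leffler_mat_def
    by (intro closed_sequentially[OF closed_subspace[OF S(1)] _
        summable_LIMSEQ[OF summable_mittag_leffler_mat[OF \<open>0 < \<alpha>\<close>]]])
qed

text \<open>The matrices commuting with \<open>B\<close> form a subspace that contains the identity
  and is stable under multiplication by \<open>M\<close>.\<close>

lemma mittag_leffler_mat_commute:
  fixes M B :: "real ^ 'n ^ 'n"
  assumes "0 < \<alpha>" and "B ** M = M ** B"
  shows "B ** mittag_leffler_mat \<alpha> M = mittag_leffler_mat \<alpha> M ** B"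
proof -
  have "mittag_leffler_mat \<alpha> M \<in> {N. B ** N = N ** B}"
  proof (rule mittag_leffler_mat_in_subspace[OF \<open>0 < \<alpha>\<close>])
    show "subspace {N. B ** N = N ** B}"
      by (intro subspaceI) (simp_all add: linear_cmul[OF linear_matrix_mult_left]
          linear_cmul[OF linear_matrix_mult_right] linear_0[OF linear_matrix_mult_left]
          linear_0[OF linear_matrix_mult_right] 
          linear_add[OF linear_matrix_mult_left] linear_add[OF linear_matrix_mult_right])
    fix N assume "N \<in> {N. B ** N = N ** B}"
    then show "M ** N \<in> {N. B ** N = N ** B}"
      using assms(2) by (simp add: matrix_mul_assoc) (simp add: matrix_mul_assoc[symmetric])
  qed simp
  then show ?thesis by simp
qed

lemma matrix_inv_mult:
  assumes "invertible P"
  shows "matrix_inv P ** P = mat 1" "P ** matrix_inv P = mat 1"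
  using someI_ex[OF assms[unfolded invertible_def]] by (simp_all add: matrix_inv_def)

text \<open>Conjugation by \<open>P\<close> is linear and multiplicative, so the preimage of
  \<open>S\<close> under it satisfies the hypotheses of the unconjugated lemma.\<close>

lemma mittag_leffler_mat_conj_in_subspace:
  fixes M P :: "real ^ 'n ^ 'n"
  assumes "0 < \<alpha>" and P: "invertible P" and S: "subspace S" "mat 1 \<in> S"
    and step: "\<And>N. N \<in> S \<Longrightarrow> (matrix_inv P ** M ** P) ** N \<in> S"
  shows "matrix_inv P ** mittag_leffler_mat \<alpha> M ** P \<in> S"
proof -
  have lin: "linear (\<lambda>N. matrix_inv P ** N ** P)"
    using linear_compose[OF linear_matrix_mult_left linear_matrix_mult_right] by (simp add: o_def)
  have "mittag_leffler_mat \<alpha> M \<in> (\<lambda>N. matrix_inv P ** N ** P) -` S"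
  proof (rule mittag_leffler_mat_in_subspace[OF \<open>0 < \<alpha>\<close>])
    show "subspace ((\<lambda>N. matrix_inv P ** N ** P) -` S)"
      by (rule linear_subspace_vimage[OF lin S(1)])
    show "mat 1 \<in> (\<lambda>N. matrix_inv P ** N ** P) -` S"
      using S matrix_inv_mult[OF P] by simp
    fix N assume "N \<in> (\<lambda>N. matrix_inv P ** N ** P) -` S"
    then have "(matrix_inv P ** M ** P) ** (matrix_inv P ** N ** P) \<in> S"
      using step by simp
    also have "(matrix_inv P ** M ** P) ** (matrix_inv P ** N ** P)
        = matrix_inv P ** M ** (P ** matrix_inv P) ** N ** P"
      by (simp only: matrix_mul_assoc)
    finally show "M ** N \<in> (\<lambda>N. matrix_inv P ** N ** P) -` S"
      by (simp add: matrix_inv_mult[OF P] matrix_mul_assoc)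
  qed
  then show ?thesis by simp
qed

section \<open>Two-by-two canonical forms\<close>

lemma mat2_nth [simp]:
  "mat2 p q r s $ 1 $ 1 = p" "mat2 p q r s $ 1 $ 2 = q"
  "mat2 p q r s $ 2 $ 1 = r" "mat2 p q r s $ 2 $ 2 = s"
  by (simp_all add: mat2_def)

lemma mat2_mult:
  "mat2 p q r s ** mat2 p' q' r' s' =
     mat2 (p * p' + q * r') (p * q' + q * s') (r * p' + s * r') (r * q' + s * (s' :: 'a::semiring_1))"
  by (simp add: vec_eq_iff forall_2 matrix_matrix_mult_def sum_2)

text \<open>This is the polar form of a complex number: modulus \<open>r\<close> times a rotation.
  The zero matrix has no angle and is written as zero scaling times the identity.\<close>

lemma scaling_rotation_matrix_mat2:
  fixes c d :: real
  shows "scaling_rotation_matrix (mat2 c d (- d) c)"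
proof (cases "c = 0 \<and> d = 0")
  case True
  then have "mat2 c d (- d) c = 0 ** mat 1" and "scaling_matrix (0 :: real ^ 2 ^ 2)"
    by (simp_all add: vec_eq_iff forall_2 scaling_matrix_def)
  moreover have "rotation_matrix (mat 1 :: real ^ 2 ^ 2)"
    by (simp add: rotation_matrix_def orthogonal_matrix_id)
  ultimately show ?thesis
    unfolding scaling_rotation_matrix_def by blast
next
  case False
  define r where "r = sqrt (c\<^sup>2 + d\<^sup>2)"
  have sq: "r\<^sup>2 = c\<^sup>2 + d\<^sup>2"
    by (simp add: r_def)
  have "r \<noteq> 0"
    using False by (simp add: r_def sum_power2_eq_zero_iff)
  have one: "(c / r)\<^sup>2 + (d / r)\<^sup>2 = 1"
    using \<open>r \<noteq> 0\<close> by (simp add: power_divide add_divide_distrib[symmetric] sq[symmetric])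
  let ?V = "mat2 (c / r) (d / r) (- d / r) (c / r)"
  have "scaling_matrix (mat2 r 0 0 r)"
    by (simp add: scaling_matrix_def forall_2)
  moreover have "transpose ?V ** ?V = mat 1"
    using one by (simp add: vec_eq_iff forall_2 matrix_matrix_mult_def sum_2 transpose_def mat_def
        power2_eq_square add.commute)
  then have "rotation_matrix ?V"
    using one by (simp add: rotation_matrix_def orthogonal_matrix det_2 power2_eq_square)
  moreover have "mat2 c d (- d) c = mat2 r 0 0 r ** ?V"
    using \<open>r \<noteq> 0\<close> by (simp add: mat2_mult)
  ultimately show ?thesis
    unfolding scaling_rotation_matrix_def by blast
qed

section \<open>Iteration of the Volterra equation\<close>

text \<open>The remainder of index \<open>n + 1\<close> is the fractional integral of
  \<open>A\<close> applied to the remainder of index \<open>n\<close>. Each round costs a factor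
  \<open>K\<close> and moves the power term on by one index.\<close>

lemma volterra_remainder:
  fixes A :: "real ^ 'n ^ 'n" and X :: "real \<Rightarrow> real ^ 'n"
  assumes "0 < \<alpha>" and cont: "continuous_on {0..S} X"
    and volterra: "\<And>t. 0 < t \<Longrightarrow> t \<le> S \<Longrightarrow> X t = X 0 + riemann_liouville \<alpha> (\<lambda>s. A *v X s) t"
    and M: "\<And>t. 0 < t \<Longrightarrow> t \<le> S \<Longrightarrow> norm (X t) \<le> M"
    and K: "0 \<le> K" "\<And>v. norm (A *v v) \<le> K * norm v"
    and t: "0 < t" "t \<le> S"
  shows "norm (X t - (\<Sum>k<n. (t powr (\<alpha> * real k) / Gamma (\<alpha> * real k + 1)) *\<^sub>R (mat_pow A k *v X 0)))
    \<le> M * K ^ n * (t powr (\<alpha> * real n) / Gamma (\<alpha> * real n + 1))"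
  using t
\<comment> \<open>The step integrates the bound over all earlier times, so the hypothesis must hold
  for every \<open>t\<close>.\<close>
proof (induction n arbitrary: t)
  case 0
  then show ?case using M by simp
next
  case (Suc n)
  let ?w = "\<lambda>k s. s powr (\<alpha> * real k) / Gamma (\<alpha> * real k + 1)"
  let ?G = "\<lambda>s. \<Sum>k<n. ?w k s *\<^sub>R (mat_pow A k *v X 0)"
  let ?k = "\<lambda>s v. indicator {0<..<t} s *\<^sub>R ((t - s) powr (\<alpha> - 1) *\<^sub>R v)"
  have w_Suc: "t powr (\<alpha> * real k + \<alpha>) / Gamma (\<alpha> * real k + \<alpha> + 1) = ?w (Suc k) t" for k
    by (simp add: algebra_simps)
  \<comment> \<open>Generic in the type of \<open>v\<close>: it serves the vector terms of the
    series as well as the real bound \<open>M * K ^ Suc n\<close>.\<close>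
  have power: "has_bochner_integral lborel (\<lambda>s. ?k s (?w k s *\<^sub>R v)) ((Gamma \<alpha> * ?w (Suc k) t) *\<^sub>R v)"
    for k and v :: "'b::{banach, second_countable_topology}"
    using has_bochner_integral_riemann_liouville_powr[of \<alpha> "\<alpha> * real k" t v] assms(1) Suc.prems
    by (simp only: w_Suc) simp
  have contAX: "continuous_on {0..t} (\<lambda>s. A *v X s)"
    using Suc.prems
    by (intro bounded_linear.continuous_on[OF matrix_vector_mul_bounded_linear continuous_on_subset[OF cont]]) auto
  have "has_bochner_integral lborel (\<lambda>s. ?k s (A *v X s)) (Gamma \<alpha> *\<^sub>R (X t - X 0))"
    using set_integrable_riemann_liouville[OF assms(1) Suc.prems(1) contAX] volterra[OF Suc.prems]
      Gamma_real_pos[OF assms(1)]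
    by (simp add: has_bochner_integral_iff riemann_liouville_def set_integrable_def set_lebesgue_integral_def)
  moreover have "has_bochner_integral lborel (\<lambda>s. \<Sum>k<n. ?k s (?w k s *\<^sub>R (mat_pow A (Suc k) *v X 0)))
      (\<Sum>k<n. (Gamma \<alpha> * ?w (Suc k) t) *\<^sub>R (mat_pow A (Suc k) *v X 0))"
    by (intro has_bochner_integral_sum power)
  ultimately have "has_bochner_integral lborel
      (\<lambda>s. ?k s (A *v X s) - (\<Sum>k<n. ?k s (?w k s *\<^sub>R (mat_pow A (Suc k) *v X 0))))
      (Gamma \<alpha> *\<^sub>R (X t - X 0) - (\<Sum>k<n. (Gamma \<alpha> * ?w (Suc k) t) *\<^sub>R (mat_pow A (Suc k) *v X 0)))"
    by (rule has_bochner_integral_diff)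
  moreover have "?k s (A *v X s) - (\<Sum>k<n. ?k s (?w k s *\<^sub>R (mat_pow A (Suc k) *v X 0)))
      = ?k s (A *v (X s - ?G s))" for s
    by (simp add: matrix_vector_mult_diff_distrib linear_sum[OF matrix_vector_mul_linear]
        matrix_vector_mult_scaleR matrix_vector_mul_assoc scaleR_sum_right scaleR_diff_right del: scaleR_scaleR)
  \<comment> \<open>The term for \<open>k = 0\<close> is \<open>X 0\<close>, since
    \<open>t powr 0\<close> is 1 for positive \<open>t\<close>; splitting it off shifts the
    index.\<close>
  moreover have "Gamma \<alpha> *\<^sub>R (X t - X 0) - (\<Sum>k<n. (Gamma \<alpha> * ?w (Suc k) t) *\<^sub>R (mat_pow A (Suc k) *v X 0))
      = Gamma \<alpha> *\<^sub>R (X t - (\<Sum>k<Suc n. ?w k t *\<^sub>R (mat_pow A k *v X 0)))"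
    using Suc.prems
    by (simp add: sum.lessThan_Suc_shift scaleR_diff_right scaleR_add_right scaleR_sum_right del: sum.lessThan_Suc)
  ultimately have rem: "has_bochner_integral lborel (\<lambda>s. ?k s (A *v (X s - ?G s)))
      (Gamma \<alpha> *\<^sub>R (X t - (\<Sum>k<Suc n. ?w k t *\<^sub>R (mat_pow A k *v X 0))))"
    by (simp only:)
  have bound: "has_bochner_integral lborel (\<lambda>s. ?k s (?w n s *\<^sub>R (M * K ^ Suc n)))
      ((Gamma \<alpha> * ?w (Suc n) t) *\<^sub>R (M * K ^ Suc n))"
    by (rule power)
  have "norm (?k s (A *v (X s - ?G s))) \<le> ?k s (?w n s *\<^sub>R (M * K ^ Suc n))" for s
  proof (cases "s \<in> {0<..<t}")
    case True
    have "norm (A *v (X s - ?G s)) \<le> K * norm (X s - ?G s)"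
      by (rule K)
    also have "\<dots> \<le> K * (M * K ^ n * ?w n s)"
      using True Suc.prems K(1) by (intro mult_left_mono Suc.IH) auto
    finally have "(t - s) powr (\<alpha> - 1) * norm (A *v (X s - ?G s))
        \<le> (t - s) powr (\<alpha> - 1) * (K * (M * K ^ n * ?w n s))"
      by (rule mult_left_mono) simp
    with True show ?thesis
      by (simp add: mult_ac)
  qed simp
  then have "norm (Gamma \<alpha> *\<^sub>R (X t - (\<Sum>k<Suc n. ?w k t *\<^sub>R (mat_pow A k *v X 0))))
      \<le> (Gamma \<alpha> * ?w (Suc n) t) *\<^sub>R (M * K ^ Suc n)"
    using Bochner_Integration.integral_norm_bound_integral[OF integrable.intros[OF rem] integrable.intros[OF bound]]
    unfolding has_bochner_integral_integral_eq[OF rem] has_bochner_integral_integral_eq[OF bound] by blast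
  then have "Gamma \<alpha> * norm (X t - (\<Sum>k<Suc n. ?w k t *\<^sub>R (mat_pow A k *v X 0)))
      \<le> Gamma \<alpha> * (M * K ^ Suc n * ?w (Suc n) t)"
    using Gamma_real_pos[OF assms(1)] by (simp add: mult_ac del: sum.lessThan_Suc)
  then show ?case
    using Gamma_real_pos[OF assms(1)] by (rule mult_left_le_imp_le)
qed

text \<open>Positivity of \<open>t\<close> matters: \<open>0 powr 0\<close> is 0, so at
  \<open>t = 0\<close> the leading term would vanish instead of giving \<open>v\<close>.\<close>

lemma mittag_leffler_mat_mult_vec_sums:
  fixes A :: "real ^ 'n ^ 'n"
  assumes "0 < \<alpha>" "0 < t"
  shows "(\<lambda>k. (t powr (\<alpha> * real k) / Gamma (\<alpha> * real k + 1)) *\<^sub>R (mat_pow A k *v v))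
    sums (mittag_leffler_mat \<alpha> ((t powr \<alpha>) *\<^sub>R A) *v v)"
proof -
  have "bounded_linear (\<lambda>M :: real ^ 'n ^ 'n. M *v v)"
    by (intro linear_conv_bounded_linear[THEN iffD1] linearI)
      (simp_all add: matrix_vector_mult_add_rdistrib scaleR_matrix_vector_assoc)
  from bounded_linear.sums[OF this summable_sums[OF summable_mittag_leffler_mat[OF assms(1)]]]
  have "(\<lambda>k. (mat_pow ((t powr \<alpha>) *\<^sub>R A) k /\<^sub>R Gamma (\<alpha> * real k + 1)) *v v)
      sums (mittag_leffler_mat \<alpha> ((t powr \<alpha>) *\<^sub>R A) *v v)"
    by (simp only: mittag_leffler_mat_def)
  moreover have "(t powr \<alpha>) ^ k = t powr (\<alpha> * real k)" for k
    using assms by (simp add: powr_powr flip: powr_realpow)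
  ultimately show ?thesis
    by (simp add: mat_pow_scaleR scaleR_matrix_vector_assoc[symmetric] divide_inverse mult_ac)
qed

text \<open>The remainder bound is \<open>M\<close> times a term of the convergent scalar series at
  \<open>K * t powr \<alpha>\<close>, so it tends to 0 and the partial sums converge to
  \<open>X t\<close> as well as to the matrix expression.\<close>

lemma caputo_solution_eq_mittag_leffler:
  fixes A :: "real ^ 'n ^ 'n"
  assumes "0 < \<alpha>" "\<alpha> < 1" and X: "caputo_solution \<alpha> A X" and "0 < t"
  shows "X t = mittag_leffler_mat \<alpha> ((t powr \<alpha>) *\<^sub>R A) *v X 0"
proof -
  have cont: "continuous_on {0..t} X"
    using X by (auto simp: caputo_solution_def intro: continuous_on_subset)
  then have "bounded (X ` {0..t})"
    by (intro compact_imp_bounded compact_continuous_image) auto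
  then obtain M where "\<forall>s\<in>{0..t}. norm (X s) \<le> M"
    by (auto simp: bounded_iff)
  then have M: "\<And>s. 0 < s \<Longrightarrow> s \<le> t \<Longrightarrow> norm (X s) \<le> M"
    by simp
  obtain K where K: "0 \<le> K" "\<And>v. norm (A *v v) \<le> K * norm v"
    using bounded_linear.nonneg_bounded[OF matrix_vector_mul_bounded_linear, of A] by (auto simp: mult.commute)
  let ?w = "\<lambda>k. t powr (\<alpha> * real k) / Gamma (\<alpha> * real k + 1)"
  let ?S = "\<lambda>n. \<Sum>k<n. ?w k *\<^sub>R (mat_pow A k *v X 0)"
  have rem: "norm (X t - ?S n) \<le> M * K ^ n * ?w n" for n
    by (rule volterra_remainder[OF assms(1) cont caputo_solution_volterra[OF assms(1-3)] M K])
      (use \<open>0 < t\<close> in auto)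
  have "(\<lambda>n. M * K ^ n * ?w n) \<longlonglongrightarrow> 0"
  proof -
    have "(\<lambda>n. (K * t powr \<alpha>) ^ n / Gamma (\<alpha> * real n + 1)) \<longlonglongrightarrow> 0"
      using K(1) assms by (intro summable_LIMSEQ_zero summable_mittag_leffler) auto
    moreover have "(t powr \<alpha>) ^ n = t powr (\<alpha> * real n)" for n
      using \<open>0 < t\<close> by (simp add: powr_powr flip: powr_realpow)
    ultimately have "(\<lambda>n. M * (K ^ n * ?w n)) \<longlonglongrightarrow> M * 0"
      by (intro tendsto_mult_left) (simp add: power_mult_distrib)
    then show ?thesis by (simp add: mult_ac)
  qed
  then have "(\<lambda>n. X t - ?S n) \<longlonglongrightarrow> 0"
    by (rule Lim_null_comparison[OF always_eventually[OF allI[OF rem]]])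
  then have "(\<lambda>n. X t - (X t - ?S n)) \<longlonglongrightarrow> X t - 0"
    by (intro tendsto_intros)
  then have "?S \<longlonglongrightarrow> X t"
    by simp
  moreover have "?S \<longlonglongrightarrow> mittag_leffler_mat \<alpha> ((t powr \<alpha>) *\<^sub>R A) *v X 0"
    using mittag_leffler_mat_mult_vec_sums[OF assms(1) \<open>0 < t\<close>] by (simp add: sums_def)
  ultimately show ?thesis
    by (rule LIMSEQ_unique)
qed

section \<open>Restarted solutions and canonical forms in the plane\<close>

theorem lemma4p2:
  fixes \<alpha> t1 :: real and A T :: "real ^ 2 ^ 2"
  assumes "0 < \<alpha>" and "\<alpha> < 1" and "0 < t1"
    and "T = mittag_leffler_mat \<alpha> ((t1 powr \<alpha>) *\<^sub>R A)"
  shows "(\<forall>(X0 :: real ^ 2) X Y.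
       caputo_solution \<alpha> A X \<and> X 0 = X0 \<and> caputo_solution \<alpha> A Y \<and> Y 0 = X t1 \<longrightarrow>
       (\<forall>t\<ge>0. Y t = T *v X t)) \<and>
    (\<forall>l1 l2. eigenvalue A l1 \<and> eigenvalue A l2 \<and> l1 \<noteq> l2 \<longrightarrow>
       (\<forall>P. invertible P \<and> matrix_inv P ** A ** P = mat2 l1 0 0 l2 \<longrightarrow>
          scaling_matrix (matrix_inv P ** T ** P))) \<and>
    (\<forall>a b. b \<noteq> 0 \<and> eigenvalue (map_matrix complex_of_real A) (Complex a b) \<and>
           eigenvalue (map_matrix complex_of_real A) (Complex a (- b)) \<longrightarrow>
       (\<forall>P. invertible P \<and> matrix_inv P ** A ** P = mat2 a b (- b) a \<longrightarrow>
          scaling_rotation_matrix (matrix_inv P ** T ** P)))"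
proof (intro conjI allI impI; (elim conjE)?)
  fix X0 :: "real ^ 2" and X Y and t :: real
  assume X: "caputo_solution \<alpha> A X" and Y: "caputo_solution \<alpha> A Y" "Y 0 = X t1" and "0 \<le> t"
  note sol = caputo_solution_eq_mittag_leffler[OF assms(1,2)]
  have X1: "X t1 = T *v X 0"
    using sol[OF X assms(3)] assms(4) by simp
  show "Y t = T *v X t"
  proof (cases "t = 0")
    case True
    then show ?thesis using Y X1 by simp
  next
    case False
    with \<open>0 \<le> t\<close> have "0 < t" by simp
    let ?E = "mittag_leffler_mat \<alpha> ((t powr \<alpha>) *\<^sub>R A)"
    \<comment> \<open>Commutation is used twice: \<open>A\<close> commutes with the series
      \<open>T\<close>, and then \<open>T\<close>, commuting with \<open>A\<close>, commutes with
      the series \<open>?E\<close>.\<close>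
    have "A ** T = T ** A"
      unfolding assms(4) by (rule mittag_leffler_mat_commute)
        (simp_all add: assms(1) linear_cmul[OF linear_matrix_mult_left] linear_cmul[OF linear_matrix_mult_right])
    then have "T ** ?E = ?E ** T"
      by (intro mittag_leffler_mat_commute)
        (simp_all add: assms(1) linear_cmul[OF linear_matrix_mult_left] linear_cmul[OF linear_matrix_mult_right])
    then show ?thesis
      using sol[OF X \<open>0 < t\<close>] sol[OF Y(1) \<open>0 < t\<close>] Y(2) X1 by (simp add: matrix_vector_mul_assoc)
  qed
next
  fix l1 l2 :: real and P :: "real ^ 2 ^ 2"
  assume P: "invertible P" "matrix_inv P ** A ** P = mat2 l1 0 0 l2"
  have "matrix_inv P ** T ** P \<in> {N. scaling_matrix N}"
    unfolding assms(4)
  proof (rule mittag_leffler_mat_conj_in_subspace[OF assms(1) P(1)])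
    show "subspace {N :: real ^ 2 ^ 2. scaling_matrix N}"
      by (rule subspaceI) (auto simp: scaling_matrix_def)
    show "mat 1 \<in> {N :: real ^ 2 ^ 2. scaling_matrix N}"
      by (simp add: scaling_matrix_def mat_def)
    fix N :: "real ^ 2 ^ 2"
    assume "N \<in> {N. scaling_matrix N}"
    moreover have "matrix_inv P ** ((t1 powr \<alpha>) *\<^sub>R A) ** P = (t1 powr \<alpha>) *\<^sub>R mat2 l1 0 0 l2"
      by (simp add: linear_cmul[OF linear_matrix_mult_left] linear_cmul[OF linear_matrix_mult_right] P(2))
    ultimately show "(matrix_inv P ** ((t1 powr \<alpha>) *\<^sub>R A) ** P) ** N \<in> {N. scaling_matrix N}"
      by (simp add: scaling_matrix_def forall_2 matrix_matrix_mult_def sum_2)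
  qed
  then show "scaling_matrix (matrix_inv P ** T ** P)" by simp
next
  fix a b :: real and P :: "real ^ 2 ^ 2"
  assume P: "invertible P" "matrix_inv P ** A ** P = mat2 a b (- b) a"
  \<comment> \<open>The copy of the complex numbers inside the real matrices, hence closed under
    products.\<close>
  let ?S = "{N :: real ^ 2 ^ 2. N $ 2 $ 2 = N $ 1 $ 1 \<and> N $ 2 $ 1 = - N $ 1 $ 2}"
  have "matrix_inv P ** T ** P \<in> ?S"
    unfolding assms(4)
  proof (rule mittag_leffler_mat_conj_in_subspace[OF assms(1) P(1)])
    show "subspace ?S"
      by (rule subspaceI) auto
    show "mat 1 \<in> ?S"
      by (simp add: mat_def)
    fix N :: "real ^ 2 ^ 2"
    assume "N \<in> ?S"
    moreover have "matrix_inv P ** ((t1 powr \<alpha>) *\<^sub>R A) ** P = (t1 powr \<alpha>) *\<^sub>R mat2 a b (- b) a"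
      by (simp add: linear_cmul[OF linear_matrix_mult_left] linear_cmul[OF linear_matrix_mult_right] P(2))
    ultimately show "(matrix_inv P ** ((t1 powr \<alpha>) *\<^sub>R A) ** P) ** N \<in> ?S"
      by (simp add: matrix_matrix_mult_def sum_2)
  qed
  then obtain c d where "matrix_inv P ** T ** P = mat2 c d (- d) c"
    by (auto simp: vec_eq_iff forall_2)
  then show "scaling_rotation_matrix (matrix_inv P ** T ** P)"
    by (simp add: scaling_rotation_matrix_mat2)
qed

end
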